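(* Let $d\in\mathbb{N}$ with $d\ge1$ and $\Delta=\partial(\sigma_{d+1})$. Then the polytope $P_\Delta$ has exactly $d+2$ vertices. In particular, $P_\Delta$ is a $(d+1)$-simplex if $d$ is odd.
   Context: Let $\sigma_{d+1}=2^{[d+2]}$ be the full simplex on vertex set $[d+2]=\{1<2<\dots<d+2\}$ and $\Delta=\partial(\sigma_{d+1})=\sigma_{d+1}\setminus\{[d+2]\}$ its boundary, a $d$-dimensional simplicial complex. The simplicial boundary map $\partial_d$ is $\partial_d(e_\sigma)=\sum_{k=1}^{d+1}(-1)^{k-1}e_{\sigma\setminus\{j_k\}}$ for a $d$-face $\sigma=\{j_1<\dots<j_{d+1}\}$, and the $d$-th Laplacian matrix is $\mathcal{L}_d(\Delta)=\partial_d^{\top}\partial_d\in\mathbb{Z}^{(d+2)\times(d+2)}$ (as $\partial_{d+1}=0$), with rows and columns ordered according to the facets $F_1,\dots,F_{d+2}$, $F_i=[d+2]\setminus\{d+3-i\}$. $P_\Delta\subseteq\mathbb{R}^{d+2}$ is the convex hull of the columns of $\mathcal{L}_d(\Delta)$. *)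

theory Defs
  imports "HOL-Analysis.Analysis" "HOL-Library.Poly_Mapping"
begin

definition full_simplex :: "nat \<Rightarrow> nat set set" where
  "full_simplex d = Pow {1..d + 2}"

definition simplex_boundary :: "nat \<Rightarrow> nat set set" where
  "simplex_boundary d = full_simplex d - {{1..d + 2}}"

(* The dimension is an integer so that the empty face has dimension -1. *)
definition faces_of_dim :: "nat set set \<Rightarrow> int \<Rightarrow> nat set set" where
  "faces_of_dim \<Delta> k = {\<sigma> \<in> \<Delta>. int (card \<sigma>) = k + 1}"

(* Chains are elements of the free abelian group on finite vertex sets; the basis element
   of \<sigma> is frag_of \<sigma>. List positions are 0-based, so the k-th smallest vertex of \<sigma>
   is sorted_list_of_set \<sigma> ! (k - 1). *)
definition simplicial_boundary :: "(nat set \<Rightarrow>\<^sub>0 int) \<Rightarrow> (nat set \<Rightarrow>\<^sub>0 int)" where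
  "simplicial_boundary =
     frag_extend (\<lambda>\<sigma>. \<Sum>k = 1..card \<sigma>.
       frag_cmul ((-1) ^ (k - 1)) (frag_of (\<sigma> - {sorted_list_of_set \<sigma> ! (k - 1)})))"

definition boundary_entry :: "nat set \<Rightarrow> nat set \<Rightarrow> int" where
  "boundary_entry \<tau> \<sigma> = Poly_Mapping.lookup (simplicial_boundary (frag_of \<sigma>)) \<tau>"

(* The entry of (transpose \<partial>_k) \<partial>_k at the k-faces \<sigma> and \<sigma>'; the rows of the matrix of
   \<partial>_k are indexed by the (k-1)-faces of \<Delta>. This is the whole k-th Laplacian when k is the
   dimension of \<Delta>, since then \<partial>_{k+1} = 0. *)
definition top_laplacian_entry :: "nat set set \<Rightarrow> int \<Rightarrow> nat set \<Rightarrow> nat set \<Rightarrow> int" where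
  "top_laplacian_entry \<Delta> k \<sigma> \<sigma>' =
     (\<Sum>\<tau> \<in> faces_of_dim \<Delta> (k - 1). boundary_entry \<tau> \<sigma> * boundary_entry \<tau> \<sigma>')"

definition facet :: "nat \<Rightarrow> nat \<Rightarrow> nat set" where
  "facet d i = {1..d + 2} - {d + 3 - i}"

(* The d+2 coordinates are indexed by a finite type 'n; pos c \<in> {1..d + 2} is the position of
   the coordinate c, so that row and column c belong to the facet F_(pos c). *)
definition laplacian_matrix :: "nat \<Rightarrow> ('n::finite \<Rightarrow> nat) \<Rightarrow> int ^ 'n ^ 'n" where
  "laplacian_matrix d pos =
     (\<chi> r c. top_laplacian_entry (simplex_boundary d) (int d) (facet d (pos r)) (facet d (pos c)))"

definition laplacian_polytope :: "nat \<Rightarrow> ('n::finite \<Rightarrow> nat) \<Rightarrow> (real ^ 'n) set" where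
  "laplacian_polytope d pos = convex hull (columns (map_matrix real_of_int (laplacian_matrix d pos)))"

end

(* The boundary of {1..d+2} - {u} contains {1..d+2} - {u,v} with a sign such that the Laplacian is
   (d+2) I - e e^T, where e_i = (-1)^i. Its columns are therefore (d+2) b_c - e_c e for the unit
   vectors b_c. The only linear relation among them, up to scaling, is the one with coefficients e;
   it is an affine relation iff the e_c sum to 0, that is, iff d is even. *)
theory Submission
  imports Defs
begin

text \<open>Turns a list position into a vertex count: the sorted list is strictly increasing, so
  the elements below entry \<open>i\<close> are exactly the entries at smaller indices.\<close>

lemma card_less_nth_sorted_list_of_set:
  fixes A :: "'a::linorder set"
  assumes "finite A" and "i < card A"
  shows "card {x \<in> A. x < sorted_list_of_set A ! i} = i"
proof -
  let ?s = "sorted_list_of_set A"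
  have sorted: "sorted_wrt (<) ?s" and set: "set ?s = A" and len: "length ?s = card A"
    using assms by auto
  have mono: "?s ! j < ?s ! k \<longleftrightarrow> j < k" if "j < card A" "k < card A" for j k
    using sorted_wrt_nth_less[OF sorted, of j k] sorted_wrt_nth_less[OF sorted, of k j] that len
    by (metis less_asym linorder_neqE_nat)
  have "{x \<in> A. x < ?s ! i} = (!) ?s ` {..<i}"
  proof (intro equalityI subsetI)
    fix x assume "x \<in> {x \<in> A. x < ?s ! i}"
    then obtain j where "j < card A" "x = ?s ! j" "?s ! j < ?s ! i"
      using set len by (metis (mono_tags, lifting) in_set_conv_nth mem_Collect_eq)
    then show "x \<in> (!) ?s ` {..<i}"
      using mono assms(2) by auto
  next
    fix x assume "x \<in> (!) ?s ` {..<i}"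
    then obtain j where j: "j < i" "x = ?s ! j" by auto
    then have "x \<in> set ?s" using assms(2) len by (metis nth_mem order.strict_trans)
    then show "x \<in> {x \<in> A. x < ?s ! i}"
      using j mono assms(2) set by auto
  qed
  moreover have "inj_on ((!) ?s) {..<i}"
    using assms(2) len by (intro inj_on_nth) auto
  ultimately show ?thesis by (simp add: card_image)
qed

text \<open>Summing over the removed vertex instead of its list position frees the sign from the
  sorted list: the exponent \<open>k - 1\<close> of the boundary map is the number of smaller
  vertices.\<close>

lemma boundary_entry_eq_sum:
  assumes "finite \<sigma>"
  shows "boundary_entry \<tau> \<sigma> =
    (\<Sum>w\<in>\<sigma>. if \<sigma> - {w} = \<tau> then (-1) ^ card {x \<in> \<sigma>. x < w} else 0)"
proof -
  let ?s = "sorted_list_of_set \<sigma>"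
  have bij: "bij_betw (\<lambda>k. ?s ! (k - 1)) {1..card \<sigma>} \<sigma>"
  proof (rule bij_betw_trans[of "\<lambda>k. k - 1" _ "{..<card \<sigma>}" "(!) ?s", unfolded comp_def])
    show "bij_betw (\<lambda>k. k - 1) {1..card \<sigma>} {..<card \<sigma>}"
      by (rule bij_betw_byWitness[of _ Suc]) auto
    show "bij_betw ((!) ?s) {..<card \<sigma>} \<sigma>"
      using assms by (intro bij_betw_nth) auto
  qed
  have "boundary_entry \<tau> \<sigma> =
      (\<Sum>k = 1..card \<sigma>. (-1) ^ (k - 1) * (if \<sigma> - {?s ! (k - 1)} = \<tau> then 1 else 0))"
    by (simp add: boundary_entry_def simplicial_boundary_def lookup_sum eq_commute[of \<tau>])
  also have "\<dots> = (\<Sum>k = 1..card \<sigma>. if \<sigma> - {?s ! (k - 1)} = \<tau>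
      then (-1) ^ card {x \<in> \<sigma>. x < ?s ! (k - 1)} else 0)"
  proof (rule sum.cong[OF refl])
    fix k assume "k \<in> {1..card \<sigma>}"
    then have "card {x \<in> \<sigma>. x < ?s ! (k - 1)} = k - 1"
      by (intro card_less_nth_sorted_list_of_set assms) auto
    then show "(-1) ^ (k - 1) * (if \<sigma> - {?s ! (k - 1)} = \<tau> then 1 else 0) =
        (if \<sigma> - {?s ! (k - 1)} = \<tau> then (-1) ^ card {x \<in> \<sigma>. x < ?s ! (k - 1)} else (0::int))"
      by simp
  qed
  also have "\<dots> = (\<Sum>w\<in>\<sigma>. if \<sigma> - {w} = \<tau> then (-1) ^ card {x \<in> \<sigma>. x < w} else 0)"
    using sum.reindex_bij_betw[OF bij] .
  finally show ?thesis .
qed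

lemma boundary_entry_remove:
  assumes "finite \<sigma>" and "w \<in> \<sigma>"
  shows "boundary_entry (\<sigma> - {w}) \<sigma> = (-1) ^ card {x \<in> \<sigma>. x < w}"
proof -
  have "boundary_entry (\<sigma> - {w}) \<sigma> =
      (\<Sum>v\<in>\<sigma>. if v = w then (-1) ^ card {x \<in> \<sigma>. x < w} else 0)"
    unfolding boundary_entry_eq_sum[OF assms(1)] using assms(2)
    by (intro sum.cong refl) auto
  then show ?thesis using assms by simp
qed

lemma boundary_entry_eq_0:
  assumes "finite \<sigma>" and "\<And>w. w \<in> \<sigma> \<Longrightarrow> \<tau> \<noteq> \<sigma> - {w}"
  shows "boundary_entry \<tau> \<sigma> = 0"
  unfolding boundary_entry_eq_sum[OF assms(1)] using assms(2) by (intro sum.neutral) auto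

text \<open>Dimension d - 1 means d vertices, too few for the full vertex set, the only face that
  the boundary complex omits.\<close>

lemma faces_of_dim_simplex_boundary:
  "\<tau> \<in> faces_of_dim (simplex_boundary d) (int d - 1) \<longleftrightarrow> \<tau> \<subseteq> {1..d + 2} \<and> card \<tau> = d"
proof -
  have "\<tau> \<noteq> {1..d + 2}" if "card \<tau> = d"
  proof
    assume "\<tau> = {1..d + 2}"
    then have "card \<tau> = d + 2" by simp
    with that show False by simp
  qed
  then show ?thesis
    by (auto simp: faces_of_dim_def simplex_boundary_def full_simplex_def)
qed

lemma finite_faces_of_dim_simplex_boundary:
  "finite (faces_of_dim (simplex_boundary d) (int d - 1))"
  by (rule finite_subset[of _ "Pow {1..d + 2}"])
    (auto simp only: faces_of_dim_simplex_boundary finite_Pow_iff finite_atLeastAtMost)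

text \<open>Only the d + 1 ridges obtained by deleting a vertex of the facet contribute, and each
  sign squares to 1.\<close>

lemma top_laplacian_entry_diagonal:
  assumes "u \<in> {1..d + 2}"
  shows "top_laplacian_entry (simplex_boundary d) (int d) ({1..d + 2} - {u}) ({1..d + 2} - {u})
    = int d + 1"
proof -
  let ?\<sigma> = "{1..d + 2} - {u}"
  let ?F = "faces_of_dim (simplex_boundary d) (int d - 1)"
  note fin = finite_faces_of_dim_simplex_boundary[of d]
  have card: "card ?\<sigma> = d + 1" using assms by simp
  have sub: "(\<lambda>w. ?\<sigma> - {w}) ` ?\<sigma> \<subseteq> ?F"
  proof (rule image_subsetI)
    fix w assume "w \<in> ?\<sigma>"
    then have "card (?\<sigma> - {w}) = d"
      using card_Diff_singleton[of w ?\<sigma>] card by simp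
    then show "?\<sigma> - {w} \<in> ?F"
      unfolding faces_of_dim_simplex_boundary by blast
  qed
  have inj: "inj_on (\<lambda>w. ?\<sigma> - {w}) ?\<sigma>"
    by (rule inj_onI) blast
  have "(\<Sum>\<tau>\<in>?F. boundary_entry \<tau> ?\<sigma> * boundary_entry \<tau> ?\<sigma>) =
      (\<Sum>\<tau>\<in>(\<lambda>w. ?\<sigma> - {w}) ` ?\<sigma>. boundary_entry \<tau> ?\<sigma> * boundary_entry \<tau> ?\<sigma>)"
  proof (intro sum.mono_neutral_right fin sub ballI)
    fix \<tau> assume "\<tau> \<in> ?F - (\<lambda>w. ?\<sigma> - {w}) ` ?\<sigma>"
    then have "boundary_entry \<tau> ?\<sigma> = 0"
      by (intro boundary_entry_eq_0) blast+
    then show "boundary_entry \<tau> ?\<sigma> * boundary_entry \<tau> ?\<sigma> = 0" by simp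
  qed
  also have "\<dots> = (\<Sum>w\<in>?\<sigma>. boundary_entry (?\<sigma> - {w}) ?\<sigma> * boundary_entry (?\<sigma> - {w}) ?\<sigma>)"
    unfolding sum.reindex[OF inj] comp_def ..
  also have "\<dots> = (\<Sum>w\<in>?\<sigma>. 1)"
    by (intro sum.cong refl) (simp add: boundary_entry_remove flip: power_mult_distrib)
  finally show ?thesis using card by (simp add: top_laplacian_entry_def)
qed

text \<open>Two distinct facets share exactly one ridge, the one missing both \<open>u\<close> and
  \<open>v\<close>, so the sum reduces to the product of its two signs.\<close>

lemma top_laplacian_entry_less:
  assumes "u \<in> {1..d + 2}" and "v \<in> {1..d + 2}" and "u < v"
  shows "top_laplacian_entry (simplex_boundary d) (int d) ({1..d + 2} - {u}) ({1..d + 2} - {v})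
    = - ((-1) ^ (u + v))"
proof -
  let ?V = "{1..d + 2}"
  let ?\<rho> = "?V - {u, v}"
  let ?F = "faces_of_dim (simplex_boundary d) (int d - 1)"
  note fin = finite_faces_of_dim_simplex_boundary[of d]
  have sub: "{?\<rho>} \<subseteq> ?F"
    using assms by (auto simp: faces_of_dim_simplex_boundary card_Diff_subset)
  have zero: "boundary_entry \<tau> (?V - {u}) * boundary_entry \<tau> (?V - {v}) = 0" if "\<tau> \<noteq> ?\<rho>" for \<tau>
  proof (rule ccontr)
    assume "\<not> ?thesis"
    then obtain w w' where "w \<in> ?V - {u}" "\<tau> = ?V - {u} - {w}" "w' \<in> ?V - {v}" "\<tau> = ?V - {v} - {w'}"
      by (metis boundary_entry_eq_0 finite_Diff finite_atLeastAtMost mult_eq_0_iff)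
    then have "\<tau> = ?\<rho>" using assms by blast
    with that show False by simp
  qed
  have rho: "?V - {u} - {v} = ?\<rho>" "?V - {v} - {u} = ?\<rho>"
    by blast+
  have "boundary_entry ?\<rho> (?V - {u}) = (-1) ^ card {x \<in> ?V - {u}. x < v}"
    using boundary_entry_remove[of "?V - {u}" v] assms unfolding rho by simp
  moreover have "{x \<in> ?V - {u}. x < v} = {1..<v} - {u}"
    using assms by auto
  moreover have "boundary_entry ?\<rho> (?V - {v}) = (-1) ^ card {x \<in> ?V - {v}. x < u}"
    using boundary_entry_remove[of "?V - {v}" u] assms unfolding rho by simp
  moreover have "{x \<in> ?V - {v}. x < u} = {1..<u}"
    using assms by auto
  \<comment> \<open>Of the v - 1 vertices below \<open>v\<close>, the first facet lacks
    \<open>u\<close>, whence v - 2; the second facet lacks no vertex below \<open>u\<close>, whence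
    u - 1.\<close>
  ultimately have "boundary_entry ?\<rho> (?V - {u}) * boundary_entry ?\<rho> (?V - {v}) =
      (-1) ^ (v - 2) * (-1) ^ (u - 1)"
    using assms by (simp add: numeral_2_eq_2)
  \<comment> \<open>Raising the exponent by the odd number 3 costs one sign and clears the truncated
    subtractions, which are exact since 1 \<le> u < v.\<close>
  also have "\<dots> = - ((-1) ^ (v - 2 + (u - 1) + 3))"
    by (simp only: power_add) simp
  also have "v - 2 + (u - 1) + 3 = u + v"
    using assms by auto
  finally show ?thesis
    using sum.mono_neutral_right[OF fin sub,
        of "\<lambda>\<tau>. boundary_entry \<tau> (?V - {u}) * boundary_entry \<tau> (?V - {v})"]
      zero by (simp add: top_laplacian_entry_def)
qed

text \<open>Scalar matrix minus a rank-one matrix: on the diagonal the signs multiply to 1, and d +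
  1 = (d + 2) - 1. The case u > v follows by symmetry of the Gram matrix.\<close>

lemma top_laplacian_entry_eq:
  assumes "u \<in> {1..d + 2}" and "v \<in> {1..d + 2}"
  shows "top_laplacian_entry (simplex_boundary d) (int d) ({1..d + 2} - {u}) ({1..d + 2} - {v})
    = (if u = v then int d + 2 else 0) - (-1) ^ u * (-1) ^ v"
proof (cases u v rule: linorder_cases)
  case equal
  then show ?thesis
    using top_laplacian_entry_diagonal[OF assms(1)] by (simp flip: power_add mult_2)
next
  case less
  then show ?thesis using top_laplacian_entry_less[OF assms] by (simp add: power_add)
next
  case greater
  have "top_laplacian_entry \<Delta> k \<sigma> \<sigma>' = top_laplacian_entry \<Delta> k \<sigma>' \<sigma>" for \<Delta> k \<sigma> \<sigma>'
    by (simp add: top_laplacian_entry_def mult.commute)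
  with greater show ?thesis
    using top_laplacian_entry_less[OF assms(2,1)] by (simp add: power_add mult.commute)
qed

text \<open>Facet i omits vertex d + 3 - i rather than i. This reversal multiplies every sign by the
  same factor (-1)^(d + 3), which cancels in a product of two signs.\<close>

lemma column_laplacian_matrix_nth:
  assumes "bij_betw pos (UNIV :: 'n::finite set) {1..d + 2}"
  shows "column c (map_matrix real_of_int (laplacian_matrix d pos)) $ r =
    (if r = c then real d + 2 else 0) - (-1) ^ pos r * (-1) ^ pos c"
proof -
  have range: "pos i \<in> {1..d + 2}" for i
    using assms by (auto simp: bij_betw_def)
  have sign: "(-1::int) ^ (d + 3 - pos i) = (-1) ^ (d + 3) * (-1) ^ pos i" for i
    using range[of i] by (auto simp: minus_one_power_iff)
  have "(-1::int) ^ (d + 3) * (-1) ^ (d + 3) = 1"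
    by (simp flip: power_mult_distrib)
  then have prod: "(-1::int) ^ (d + 3 - pos i) * (-1) ^ (d + 3 - pos j) =
      (-1) ^ pos i * (-1) ^ pos j" for i j
    unfolding sign by (metis mult.assoc mult.left_commute mult_1)
  have eq: "d + 3 - pos r = d + 3 - pos c \<longleftrightarrow> r = c"
    using range[of r] range[of c] inj_eq[of pos r c] assms by (auto simp: bij_betw_def)
  have "d + 3 - pos i \<in> {1..d + 2}" for i
    using range[of i] by auto
  from top_laplacian_entry_eq[OF this this, of r c] show ?thesis
    by (simp add: column_def map_matrix_def laplacian_matrix_def facet_def prod eq)
qed

theorem corollary4p7:
  fixes d :: nat and pos :: "'n::finite \<Rightarrow> nat"
  assumes "d \<ge> 1"
    and "bij_betw pos (UNIV :: 'n set) {1..d + 2}"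
  shows "card {v. v extreme_point_of laplacian_polytope d pos} = d + 2 \<and>
    (odd d \<longrightarrow> (int d + 1) simplex laplacian_polytope d pos)"
proof -
  define C where "C c = column c (map_matrix real_of_int (laplacian_matrix d pos))" for c
  let ?S = "range C"
  have nth: "C c $ r = (if r = c then real d + 2 else 0) - (-1) ^ pos r * (-1) ^ pos c" for c r
    unfolding C_def by (rule column_laplacian_matrix_nth[OF assms(2)])
  have diag: "C c $ c = real d + 1" for c
    by (simp add: nth flip: power_mult_distrib)
  have offdiag: "C c $ r \<le> 1" if "c \<noteq> r" for c r
    using that by (auto simp: nth minus_one_power_iff)
  have polytope: "laplacian_polytope d pos = convex hull ?S"
    unfolding laplacian_polytope_def columns_def C_def
    by (rule arg_cong[where f = "(hull) convex"]) auto
  \<comment> \<open>If columns c and c' agreed, their coordinate c' would be both d + 1 and at most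
    1, which d \<ge> 1 excludes.\<close>
  have inj: "inj C"
  proof (rule injI, rule ccontr)
    fix c c' assume "C c = C c'" "c \<noteq> c'"
    then have "real d + 1 \<le> 1" using offdiag[of c c'] diag[of c'] by simp
    then show False using assms(1) by simp
  qed
  have "CARD('n) = d + 2"
    using bij_betw_same_card[OF assms(2)] by simp
  then have card: "card ?S = d + 2"
    using card_image[OF inj] by simp

  text \<open>On the columns, coordinate \<open>c\<close> attains its maximum only at column \<open>c\<close>, since
    \<open>d + 1 > 1\<close>; so every column is a vertex.\<close>
  have "C c \<notin> convex hull (?S - {C c})" for c
  proof
    assume "C c \<in> convex hull (?S - {C c})"
    moreover have "?S - {C c} \<subseteq> {x. x $ c \<le> 1}"
    proof
      fix x assume "x \<in> ?S - {C c}"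
      then obtain c' where "x = C c'" "c' \<noteq> c" by blast
      then show "x \<in> {x. x $ c \<le> 1}" using offdiag[of c' c] by simp
    qed
    \<comment> \<open>Coordinate \<open>c\<close> is the inner product with \<open>axis c 1\<close>,
      so the set is a half-space, and being convex it absorbs the hull.\<close>
    then have "convex hull (?S - {C c}) \<subseteq> {x. x $ c \<le> 1}"
      using convex_halfspace_le[of "axis c (1::real)" 1]
      by (intro hull_minimal) (simp_all add: inner_axis')
    ultimately have "C c $ c \<le> 1" by blast
    then show False using assms(1) by (simp add: diag)
  qed
  then have "x extreme_point_of (convex hull ?S) \<longleftrightarrow> x \<in> ?S" for x
    by (intro extreme_point_of_convex_hull_convex_independent finite_imp_compact) auto
  then have "card {v. v extreme_point_of laplacian_polytope d pos} = d + 2"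
    by (simp add: polytope card)
  moreover have "(int d + 1) simplex laplacian_polytope d pos" if "odd d"
  proof -
    have "\<not> affine_dependent ?S"
    proof
      assume "affine_dependent ?S"
      then obtain U where U: "sum U ?S = 0" "\<exists>v\<in>?S. U v \<noteq> 0" "(\<Sum>v\<in>?S. U v *\<^sub>R v) = 0"
        by (auto simp: affine_dependent_explicit_finite)
      \<comment> \<open>\<open>t\<close> pairs the coefficients with the sign vector. Coordinate r
        of the linear relation then shows that \<open>U\<close> is a multiple of the sign
        vector.\<close>
      define t where "t = (\<Sum>c\<in>UNIV. (-1) ^ pos c * U (C c))"
      have *: "(real d + 2) * U (C r) = (-1) ^ pos r * t" for r
      proof -
        have "0 = (\<Sum>c\<in>UNIV. U (C c) * C c $ r)"
          using arg_cong[OF U(3), of "\<lambda>x. x $ r"] by (simp add: sum.reindex[OF inj])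
        also have "\<dots> = (\<Sum>c\<in>UNIV. (if r = c then U (C c) * (real d + 2) else 0)
            - (-1) ^ pos r * ((-1) ^ pos c * U (C c)))"
          by (intro sum.cong refl) (auto simp: nth algebra_simps)
        also have "\<dots> = U (C r) * (real d + 2) - (-1) ^ pos r * t"
          by (simp add: sum_subtractf t_def sum_distrib_left)
        finally show ?thesis by (simp add: mult.commute)
      qed
      \<comment> \<open>Now the affine condition enters: the coefficients sum to 0, so
        \<open>t\<close> times the sum of all signs vanishes.\<close>
      have "0 = (\<Sum>r\<in>UNIV. (real d + 2) * U (C r))"
        using U(1) by (simp add: sum.reindex[OF inj] flip: sum_distrib_left)
      also have "\<dots> = (\<Sum>r\<in>UNIV. (-1) ^ pos r) * t"
        by (simp add: * sum_distrib_right)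
      also have "(\<Sum>r\<in>UNIV. (-1::real) ^ pos r) = (\<Sum>k = 1..d + 2. (-1) ^ k)"
        using sum.reindex_bij_betw[OF assms(2)] .
      \<comment> \<open>For odd d there are oddly many alternating signs, starting with -1, so one
        -1 is left over.\<close>
      also have "\<dots> = -1"
      proof -
        have "(\<Sum>k = 1..n. (-1::real) ^ k) = (if odd n then -1 else 0)" for n :: nat
          by (induction n) auto
        then show ?thesis using that by simp
      qed
      finally have "t = 0" by simp
      then have "U (C r) = 0" for r using *[of r] by (auto simp: add_eq_0_iff)
      with U(2) show False by auto
    qed
    then show ?thesis unfolding simplex_def polytope using card by (intro exI[of _ ?S]) auto
  qed
  ultimately show ?thesis by simp
qed

end
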